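(* Let $\mathcal{K}\subseteq\mathbb{R}^n$ be a closed convex cone, let $\mathbf{Q},\mathbf{R}\in\mathbb{R}^{n\times k}$, $\mathbf{S}\in\mathbb{R}^{n\times m}$, $\mathbf{u},\mathbf{v}\in\mathbb{R}^k$, $\mathbf{w}\in\mathbb{R}^m$, $\mathbf{p}\in\mathbb{R}^n$, and consider the conic geometric program (CGP) $$\inf_{\mathbf{x}\in\mathbb{R}^n}\ \mathbf{p}'\mathbf{x}\quad\text{s.t.}\quad \exp\{\mathbf{Q}'\mathbf{x}-\mathbf{u}\}+\mathbf{R}'\mathbf{x}-\mathbf{v}\le\mathbf{0},\quad \mathbf{S}'\mathbf{x}=\mathbf{w},\quad \mathbf{x}\in\mathcal{K}.$$ Then the (Lagrangian) dual of this CGP is the following convex optimization problem: $$\sup_{\boldsymbol{\nu},\boldsymbol{\lambda}\in\mathbb{R}^k_+,\ \boldsymbol{\delta}\in\mathbb{R}^m}\ -\big[D(\boldsymbol{\nu},e\boldsymbol{\lambda})+\mathbf{u}'\boldsymbol{\nu}+\mathbf{v}'\boldsymbol{\lambda}+\mathbf{w}'\boldsymbol{\delta}\big]\quad\text{s.t.}\quad \mathbf{p}+\mathbf{Q}\boldsymbol{\nu}+\mathbf{R}\boldsymbol{\lambda}+\mathbf{S}\boldsymbol{\delta}\in\mathcal{K}^\star,$$ where $e$ is the Euler constant (the base of the natural logarithm).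
   Context: Primes denote transposes. For a vector $\mathbf{a}$, $\exp\{\mathbf{a}\}$ is the elementwise exponential, and $\le$ between vectors is elementwise. $\mathbb{R}^k_+$ is the set of entrywise nonnegative vectors. The dual cone is $\mathcal{K}^\star=\{\boldsymbol{\mu}\in\mathbb{R}^n \mid \mathbf{x}'\boldsymbol{\mu}\ge 0\ \forall\,\mathbf{x}\in\mathcal{K}\}$. The relative entropy of $\boldsymbol{\nu},\boldsymbol{\lambda}\in\mathbb{R}^k_+$ is $D(\boldsymbol{\nu},\boldsymbol{\lambda})=\sum_{i=1}^k \nu_i\log(\nu_i/\lambda_i)$, with the conventions that a term with $\nu_i=0$ equals $0$ (in particular $D(\mathbf{0},\mathbf{0})=0$) and a term with $\nu_i>0$, $\lambda_i=0$ equals $+\infty$. Meaning of "dual": let $\chi(\mathbf{y},\mathbf{z})=0$ if $\exp\{\mathbf{y}\}+\mathbf{z}\le\mathbf{0}$ and $+\infty$ otherwise, for $\mathbf{y},\mathbf{z}\in\mathbb{R}^k$. The CGP is written equivalently as the minimization of $\mathbf{p}'\mathbf{x}+\chi(\mathbf{y},\mathbf{z})$ over $\mathbf{x}\in\mathbb{R}^n$, $\mathbf{y},\mathbf{z}\in\mathbb{R}^k$ subject to $\mathbf{Q}'\mathbf{x}-\mathbf{u}\le\mathbf{y}$, $\mathbf{R}'\mathbf{x}-\mathbf{v}\le\mathbf{z}$, $\mathbf{S}'\mathbf{x}=\mathbf{w}$, $\mathbf{x}\in\mathcal{K}$. With multipliers $\boldsymbol{\nu},\boldsymbol{\lambda}\in\mathbb{R}^k_+$,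 $\boldsymbol{\delta}\in\mathbb{R}^m$, $\boldsymbol{\mu}\in\mathcal{K}^\star$ its Lagrangian is $$L=\mathbf{p}'\mathbf{x}+\chi(\mathbf{y},\mathbf{z})+(\mathbf{Q}'\mathbf{x}-\mathbf{u}-\mathbf{y})'\boldsymbol{\nu}+(\mathbf{R}'\mathbf{x}-\mathbf{v}-\mathbf{z})'\boldsymbol{\lambda}+(\mathbf{S}'\mathbf{x}-\mathbf{w})'\boldsymbol{\delta}-\mathbf{x}'\boldsymbol{\mu},$$ and the dual problem is to maximize $\inf_{\mathbf{x},\mathbf{y},\mathbf{z}}L$ over all such $(\boldsymbol{\nu},\boldsymbol{\lambda},\boldsymbol{\delta},\boldsymbol{\mu})$, where $\boldsymbol{\mu}$ is eliminated and dual variables at which the infimum over $\mathbf{x}$ is $-\infty$ because of a nonzero coefficient of $\mathbf{x}$ are excluded by the constraint. A convex optimization problem means maximization of a concave function over a convex set. *)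

theory Defs
  imports "HOL-Analysis.Analysis"
begin

text \<open>
  A matrix in R^(n x k) is an element of \<open>real ^ 'k ^ 'n\<close> (n rows, k columns), and \<open>\<le>\<close> on
  \<open>real ^ 'k\<close> is the componentwise order of HOL-Analysis.
\<close>

definition dual_cone :: "'a::real_inner set \<Rightarrow> 'a set" where
  "dual_cone K = {\<mu>. \<forall>x\<in>K. 0 \<le> x \<bullet> \<mu>}"

definition exp_vec :: "real ^ 'k \<Rightarrow> real ^ 'k" where
  "exp_vec a = (\<chi> i. exp (a $ i))"

text \<open>Only used for nonnegative vectors; no term of the sum is \<open>-\<infinity>\<close>.\<close>

definition rel_entropy :: "real ^ 'k \<Rightarrow> real ^ 'k \<Rightarrow> ereal" where
  "rel_entropy \<nu> lam =
     (\<Sum>i\<in>UNIV. if \<nu> $ i = 0 then 0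
               else if lam $ i = 0 then \<infinity>
               else ereal (\<nu> $ i * ln (\<nu> $ i / lam $ i)))"

text \<open>Requiring \<open>f x \<noteq> \<infinity>\<close> keeps the sum in the inequality free of \<open>\<infinity> - \<infinity>\<close>.\<close>

definition concave_ereal_on :: "'a::real_vector set \<Rightarrow> ('a \<Rightarrow> ereal) \<Rightarrow> bool" where
  "concave_ereal_on A f \<longleftrightarrow> convex A \<and> (\<forall>x\<in>A. f x \<noteq> \<infinity>) \<and>
     (\<forall>x\<in>A. \<forall>y\<in>A. \<forall>t::real. 0 \<le> t \<longrightarrow> t \<le> 1 \<longrightarrow>
        ereal (1 - t) * f x + ereal t * f y \<le> f ((1 - t) *\<^sub>R x + t *\<^sub>R y))"

definition cgp_feasible ::
  "(real ^ 'n) set \<Rightarrow> real ^ 'k ^ 'n \<Rightarrow> real ^ 'k ^ 'n \<Rightarrow> real ^ 'm ^ 'n \<Rightarrow>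
   real ^ 'k \<Rightarrow> real ^ 'k \<Rightarrow> real ^ 'm \<Rightarrow> (real ^ 'n) set" where
  "cgp_feasible K Q R S u v w =
     {x. exp_vec (transpose Q *v x - u) + transpose R *v x - v \<le> 0 \<and>
         transpose S *v x = w \<and> x \<in> K}"

definition exp_indicator :: "real ^ 'k \<Rightarrow> real ^ 'k \<Rightarrow> ereal" where
  "exp_indicator y z = (if exp_vec y + z \<le> 0 then 0 else \<infinity>)"

definition split_feasible ::
  "(real ^ 'n) set \<Rightarrow> real ^ 'k ^ 'n \<Rightarrow> real ^ 'k ^ 'n \<Rightarrow> real ^ 'm ^ 'n \<Rightarrow>
   real ^ 'k \<Rightarrow> real ^ 'k \<Rightarrow> real ^ 'm \<Rightarrow> ((real ^ 'n) \<times> (real ^ 'k) \<times> (real ^ 'k)) set" where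
  "split_feasible K Q R S u v w =
     {(x, y, z). transpose Q *v x - u \<le> y \<and> transpose R *v x - v \<le> z \<and>
                 transpose S *v x = w \<and> x \<in> K}"

definition lagrangian ::
  "real ^ 'n \<Rightarrow> real ^ 'k ^ 'n \<Rightarrow> real ^ 'k ^ 'n \<Rightarrow> real ^ 'm ^ 'n \<Rightarrow>
   real ^ 'k \<Rightarrow> real ^ 'k \<Rightarrow> real ^ 'm \<Rightarrow>
   real ^ 'n \<Rightarrow> real ^ 'k \<Rightarrow> real ^ 'k \<Rightarrow>
   real ^ 'k \<Rightarrow> real ^ 'k \<Rightarrow> real ^ 'm \<Rightarrow> real ^ 'n \<Rightarrow> ereal" where
  "lagrangian p Q R S u v w x y z \<nu> lam \<delta> \<mu> =
     ereal (p \<bullet> x) + exp_indicator y z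
     + ereal ((transpose Q *v x - u - y) \<bullet> \<nu>)
     + ereal ((transpose R *v x - v - z) \<bullet> lam)
     + ereal ((transpose S *v x - w) \<bullet> \<delta>)
     - ereal (x \<bullet> \<mu>)"

definition multipliers ::
  "(real ^ 'n) set \<Rightarrow> ((real ^ 'k) \<times> (real ^ 'k) \<times> (real ^ 'm) \<times> (real ^ 'n)) set" where
  "multipliers K = {(\<nu>, lam, \<delta>, \<mu>). 0 \<le> \<nu> \<and> 0 \<le> lam \<and> \<mu> \<in> dual_cone K}"

definition dual_function ::
  "real ^ 'n \<Rightarrow> real ^ 'k ^ 'n \<Rightarrow> real ^ 'k ^ 'n \<Rightarrow> real ^ 'm ^ 'n \<Rightarrow>
   real ^ 'k \<Rightarrow> real ^ 'k \<Rightarrow> real ^ 'm \<Rightarrow>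
   (real ^ 'k) \<times> (real ^ 'k) \<times> (real ^ 'm) \<times> (real ^ 'n) \<Rightarrow> ereal" where
  "dual_function p Q R S u v w = (\<lambda>(\<nu>, lam, \<delta>, \<mu>).
     INF (x, y, z)\<in>UNIV. lagrangian p Q R S u v w x y z \<nu> lam \<delta> \<mu>)"

text \<open>
  The multipliers that are not excluded: those at which the infimum over \<open>x\<close> alone, with \<open>y\<close>
  and \<open>z\<close> held fixed, is not \<open>-\<infinity>\<close>.  For fixed \<open>y\<close> and \<open>z\<close> the Lagrangian is affine in \<open>x\<close> (or
  constantly \<open>\<infinity>\<close>, where the indicator is infinite), so only a nonzero coefficient of \<open>x\<close> can
  exclude a multiplier.  Multipliers at which the infimum over \<open>(x, y, z)\<close> is \<open>-\<infinity>\<close> because of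
  \<open>(y, z)\<close> are kept.
\<close>

definition x_bounded_multipliers ::
  "(real ^ 'n) set \<Rightarrow> real ^ 'n \<Rightarrow> real ^ 'k ^ 'n \<Rightarrow> real ^ 'k ^ 'n \<Rightarrow> real ^ 'm ^ 'n \<Rightarrow>
   real ^ 'k \<Rightarrow> real ^ 'k \<Rightarrow> real ^ 'm \<Rightarrow>
   ((real ^ 'k) \<times> (real ^ 'k) \<times> (real ^ 'm) \<times> (real ^ 'n)) set" where
  "x_bounded_multipliers K p Q R S u v w =
     {(\<nu>, lam, \<delta>, \<mu>) \<in> multipliers K.
        \<forall>y z. (INF x. lagrangian p Q R S u v w x y z \<nu> lam \<delta> \<mu>) \<noteq> -\<infinity>}"

text \<open>The Lagrangian dual, with \<open>\<mu>\<close> eliminated by projection and partial maximization.\<close>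

definition dual_feasible ::
  "(real ^ 'n) set \<Rightarrow> real ^ 'n \<Rightarrow> real ^ 'k ^ 'n \<Rightarrow> real ^ 'k ^ 'n \<Rightarrow> real ^ 'm ^ 'n \<Rightarrow>
   real ^ 'k \<Rightarrow> real ^ 'k \<Rightarrow> real ^ 'm \<Rightarrow> ((real ^ 'k) \<times> (real ^ 'k) \<times> (real ^ 'm)) set" where
  "dual_feasible K p Q R S u v w =
     {(\<nu>, lam, \<delta>). \<exists>\<mu>. (\<nu>, lam, \<delta>, \<mu>) \<in> x_bounded_multipliers K p Q R S u v w}"

definition dual_objective ::
  "(real ^ 'n) set \<Rightarrow> real ^ 'n \<Rightarrow> real ^ 'k ^ 'n \<Rightarrow> real ^ 'k ^ 'n \<Rightarrow> real ^ 'm ^ 'n \<Rightarrow>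
   real ^ 'k \<Rightarrow> real ^ 'k \<Rightarrow> real ^ 'm \<Rightarrow> (real ^ 'k) \<times> (real ^ 'k) \<times> (real ^ 'm) \<Rightarrow> ereal" where
  "dual_objective K p Q R S u v w = (\<lambda>(\<nu>, lam, \<delta>).
     SUP \<mu>\<in>{\<mu>. (\<nu>, lam, \<delta>, \<mu>) \<in> x_bounded_multipliers K p Q R S u v w}.
       dual_function p Q R S u v w (\<nu>, lam, \<delta>, \<mu>))"

definition entropy_feasible ::
  "(real ^ 'n) set \<Rightarrow> real ^ 'n \<Rightarrow> real ^ 'k ^ 'n \<Rightarrow> real ^ 'k ^ 'n \<Rightarrow> real ^ 'm ^ 'n \<Rightarrow>
   ((real ^ 'k) \<times> (real ^ 'k) \<times> (real ^ 'm)) set" where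
  "entropy_feasible K p Q R S =
     {(\<nu>, lam, \<delta>). 0 \<le> \<nu> \<and> 0 \<le> lam \<and>
        p + Q *v \<nu> + R *v lam + S *v \<delta> \<in> dual_cone K}"

definition entropy_objective ::
  "real ^ 'k \<Rightarrow> real ^ 'k \<Rightarrow> real ^ 'm \<Rightarrow> (real ^ 'k) \<times> (real ^ 'k) \<times> (real ^ 'm) \<Rightarrow> ereal" where
  "entropy_objective u v w = (\<lambda>(\<nu>, lam, \<delta>).
     - (rel_entropy \<nu> (exp 1 *\<^sub>R lam) + ereal (u \<bullet> \<nu>) + ereal (v \<bullet> lam) + ereal (w \<bullet> \<delta>)))"

end

theory Submission
  imports Defs
begin

text \<open>
  Minimising \<open>\<lambda> e\<^sup>y - \<nu> y\<close> over a real \<open>y\<close> gives \<open>-\<nu> ln (\<nu> / (e \<lambda>))\<close>, with the right conventions at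
  the boundary, so the relative entropy \<open>D(\<nu>, e \<lambda>)\<close> is the support function of the set
  \<open>{(y, z). exp y + z \<le> 0}\<close>.  The Lagrangian is affine in \<open>x\<close> with coefficient
  \<open>p + Q \<nu> + R \<lambda> + S \<delta> - \<mu>\<close>, so its infimum is \<open>-\<infinity>\<close> unless \<open>\<mu>\<close> equals
  \<open>p + Q \<nu> + R \<lambda> + S \<delta>\<close>, and in that case it is the entropy objective.  As an infimum of affine
  functions, the objective is concave.
\<close>

section \<open>Scalar conjugate of the exponential\<close>

text \<open>Fenchel-Young inequality for exp: since \<open>b\<close> is nonnegative,
  \<open>z\<close> may be replaced by its largest value \<open>- exp y\<close>, and the rest is the
  tangent inequality \<open>ln s \<le> s - 1\<close>.\<close>

lemma exp_conjugate_upper: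
  fixes a b y z :: real
  assumes "0 \<le> a" "0 \<le> b" "exp y + z \<le> 0"
  shows "ereal (y * a + z * b) \<le>
    (if a = 0 then 0 else if exp 1 * b = 0 then \<infinity> else ereal (a * ln (a / (exp 1 * b))))"
proof -
  have zb: "z * b \<le> - exp y * b"
    using assms by (intro mult_right_mono) auto
  consider "a = 0" | "a > 0" "b = 0" | "a > 0" "b > 0"
    using assms by fastforce
  then show ?thesis
  proof cases
    case 1
    have "z * b \<le> 0"
      using zb assms(2) by (smt (verit) exp_gt_zero mult_nonneg_nonneg mult_minus_left)
    then show ?thesis using 1 by simp
  next
    case 2
    then show ?thesis by simp
  next
    case 3
    \<comment> \<open>The ratio of \<open>exp y\<close> to its optimal value \<open>a / b\<close>;
      the tangent inequality is tight at \<open>s = 1\<close>, so the resulting bound is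
      sharp.\<close>
    define s where "s = b * exp y / a"
    have s: "s > 0" using 3 by (simp add: s_def)
    have "ln s = ln b + y - ln a"
      using 3 by (simp add: s_def ln_div ln_mult)
    moreover have "ln s \<le> s - 1" using s ln_le_minus_one by blast
    ultimately have "a * (ln b + y - ln a) \<le> a * (s - 1)"
      using 3 by (intro mult_left_mono) auto
    also have "a * (s - 1) = b * exp y - a"
      using 3 by (simp add: s_def field_simps)
    finally have "y * a + z * b \<le> a * (ln a - (1 + ln b))"
      using zb by (simp add: algebra_simps)
    then show ?thesis using 3 by (simp add: ln_div ln_mult)
  qed
qed

text \<open>Sharpness of the preceding bound along \<open>z = - exp y\<close>. A sequence is used
  because at the boundary of the quadrant the supremum may be infinite or only approached as
  \<open>y\<close> tends to minus infinity.\<close>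

lemma exp_conjugate_attained:
  fixes a b :: real
  assumes "0 \<le> a" "0 \<le> b"
  obtains y :: "nat \<Rightarrow> real" where
    "(\<lambda>n. ereal (y n * a - exp (y n) * b)) \<longlonglongrightarrow>
      (if a = 0 then 0 else if exp 1 * b = 0 then \<infinity> else ereal (a * ln (a / (exp 1 * b))))"
proof -
  consider "a = 0" | "a > 0" "b = 0" | "a > 0" "b > 0"
    using assms by fastforce
  then show ?thesis
  proof cases
    case 1
    have "(\<lambda>n. - exp (- real n) * b) \<longlonglongrightarrow> - 0 * b"
      by (intro tendsto_intros filterlim_compose[OF exp_at_bot])
        (simp add: filterlim_uminus_at_bot filterlim_real_sequentially)
    then have "(\<lambda>n. ereal (- real n * a - exp (- real n) * b)) \<longlonglongrightarrow> 0"
      using 1 by (simp add: zero_ereal_def)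
    with 1 that[of "\<lambda>n. - real n"] show ?thesis by simp
  next
    case 2
    have "filterlim (\<lambda>n. real n * a) at_top sequentially"
      using 2 by (intro filterlim_at_top_mult_tendsto_pos[OF tendsto_const])
        (auto simp: filterlim_real_sequentially)
    then have "(\<lambda>n. ereal (real n * a)) \<longlonglongrightarrow> \<infinity>"
      by (simp add: tendsto_PInfty_eq_at_top)
    with 2 that[of real] show ?thesis by simp
  next
    case 3
    \<comment> \<open>\<open>ln (a / b)\<close> is the zero of the derivative
      \<open>a - b * exp y\<close>, so a constant sequence suffices here.\<close>
    have e: "exp (ln (a / b)) * b = a" using 3 by simp
    have "ln (a / b) * a - exp (ln (a / b)) * b = a * ln (a / (exp 1 * b))"
      unfolding e using 3 by (simp add: ln_div ln_mult algebra_simps)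
    with 3 that[of "\<lambda>_. ln (a / b)"] show ?thesis by simp
  qed
qed

section \<open>Relative entropy as a support function\<close>

lemma sum_not_MInfty:
  fixes l :: "'i \<Rightarrow> ereal"
  assumes "\<And>i. i \<in> I \<Longrightarrow> l i \<noteq> -\<infinity>"
  shows "sum l I \<noteq> -\<infinity>"
  using assms by (induction I rule: infinite_finite_induct) auto

text \<open>Addition of extended reals is discontinuous only where infinities of opposite sign meet;
  excluding \<open>-\<infinity>\<close> from all limits rules this out.\<close>

lemma tendsto_sum_ereal_not_MInfty:
  fixes f :: "'i \<Rightarrow> 'x \<Rightarrow> ereal"
  assumes "\<And>i. i \<in> I \<Longrightarrow> (f i \<longlongrightarrow> l i) F" "\<And>i. i \<in> I \<Longrightarrow> l i \<noteq> -\<infinity>"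
  shows "((\<lambda>x. \<Sum>i\<in>I. f i x) \<longlongrightarrow> (\<Sum>i\<in>I. l i)) F"
  using assms
proof (induction I rule: infinite_finite_induct)
  case (insert i I)
  then show ?case
    by (auto intro!: tendsto_add_ereal_general simp: sum_not_MInfty)
qed auto

text \<open>The constraint decouples over coordinates, so the scalar bound can be summed, and
  maximising sequences chosen per coordinate combine into one sequence of vectors.\<close>

lemma rel_entropy_eq_SUP:
  fixes \<nu> lam :: "real ^ 'k"
  assumes "0 \<le> \<nu>" "0 \<le> lam"
  shows "rel_entropy \<nu> (exp 1 *\<^sub>R lam) =
    (SUP (y, z)\<in>{(y, z). exp_vec y + z \<le> 0}. ereal (y \<bullet> \<nu> + z \<bullet> lam))"
proof (rule antisym)
  define h where "h i = (if \<nu> $ i = 0 then 0 else if exp 1 * lam $ i = 0 then \<infinity>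
    else ereal (\<nu> $ i * ln (\<nu> $ i / (exp 1 * lam $ i))))" for i
  have nonneg: "0 \<le> \<nu> $ i" "0 \<le> lam $ i" for i
    using assms by (auto simp: less_eq_vec_def)
  have D: "rel_entropy \<nu> (exp 1 *\<^sub>R lam) = sum h UNIV"
    by (simp add: rel_entropy_def h_def cong: if_cong)
  show "(SUP (y, z)\<in>{(y, z). exp_vec y + z \<le> 0}. ereal (y \<bullet> \<nu> + z \<bullet> lam))
      \<le> rel_entropy \<nu> (exp 1 *\<^sub>R lam)"
  proof (rule SUP_least, clarify)
    fix y z :: "real ^ 'k"
    assume "exp_vec y + z \<le> 0"
    then have "exp (y $ i) + z $ i \<le> 0" for i
      by (auto simp: less_eq_vec_def exp_vec_def)
    then have "(\<Sum>i\<in>UNIV. ereal (y $ i * \<nu> $ i + z $ i * lam $ i)) \<le> sum h UNIV"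
      unfolding h_def using nonneg by (intro sum_mono exp_conjugate_upper) auto
    then show "ereal (y \<bullet> \<nu> + z \<bullet> lam) \<le> rel_entropy \<nu> (exp 1 *\<^sub>R lam)"
      by (simp add: D inner_vec_def sum.distrib)
  qed
  have "\<exists>y. (\<lambda>n. ereal (y n * \<nu> $ i - exp (y n) * lam $ i)) \<longlonglongrightarrow> h i" for i
    unfolding h_def
    by (rule exp_conjugate_attained[OF nonneg(1)[of i] nonneg(2)[of i]]) (rule exI)
  then have "\<exists>Y. \<forall>i. (\<lambda>n. ereal (Y i n * \<nu> $ i - exp (Y i n) * lam $ i)) \<longlonglongrightarrow> h i"
    by (intro choice allI)
  then obtain Y where
    "(\<lambda>n. ereal (Y i n * \<nu> $ i - exp (Y i n) * lam $ i)) \<longlonglongrightarrow> h i" for i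
    by blast
  then have "(\<lambda>n. \<Sum>i\<in>UNIV. ereal (Y i n * \<nu> $ i - exp (Y i n) * lam $ i)) \<longlonglongrightarrow> sum h UNIV"
    by (rule tendsto_sum_ereal_not_MInfty) (simp add: h_def)
  moreover have "(\<Sum>i\<in>UNIV. ereal (Y i n * \<nu> $ i - exp (Y i n) * lam $ i))
      \<le> (SUP (y, z)\<in>{(y, z). exp_vec y + z \<le> 0}. ereal (y \<bullet> \<nu> + z \<bullet> lam))" for n
    \<comment> \<open>The pair meets the constraint with equality, as in the scalar case.\<close>
    by (rule SUP_upper2[where i = "(\<chi> i. Y i n, - exp_vec (\<chi> i. Y i n))"])
      (auto simp: inner_vec_def exp_vec_def sum.distrib[symmetric])
  ultimately show "rel_entropy \<nu> (exp 1 *\<^sub>R lam)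
      \<le> (SUP (y, z)\<in>{(y, z). exp_vec y + z \<le> 0}. ereal (y \<bullet> \<nu> + z \<bullet> lam))"
    unfolding D by (intro LIMSEQ_le_const2) auto
qed

text \<open>Supplies one pair at which the indicator vanishes: it makes index sets nonempty and
  gives a place where the Lagrangian is finite.\<close>

lemma exp_vec_add_le_0_witness: "exp_vec (0 :: real ^ 'k) + (- 1) \<le> 0"
  by (simp add: exp_vec_def less_eq_vec_def)

text \<open>Negation turns the support function into an infimum of functions that are affine in
  \<open>(\<nu>, lam, \<delta>)\<close>. This form serves both the comparison with the dual function
  and concavity.\<close>

lemma entropy_objective_eq_INF:
  fixes \<nu> lam u v :: "real ^ 'k"
  assumes "0 \<le> \<nu>" "0 \<le> lam"
  shows "entropy_objective u v w (\<nu>, lam, \<delta>) =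
    (INF (y, z)\<in>{(y, z). exp_vec y + z \<le> 0}.
      ereal (- (y \<bullet> \<nu> + z \<bullet> lam + (u \<bullet> \<nu> + v \<bullet> lam + w \<bullet> \<delta>))))"
proof -
  define A where "A = {(y, z :: real ^ 'k). exp_vec y + z \<le> 0}"
  define c where "c = u \<bullet> \<nu> + v \<bullet> lam + w \<bullet> \<delta>"
  have ne: "A \<noteq> {}" using exp_vec_add_le_0_witness unfolding A_def by blast
  have "entropy_objective u v w (\<nu>, lam, \<delta>) =
      - ((SUP (y, z)\<in>A. ereal (y \<bullet> \<nu> + z \<bullet> lam)) + ereal c)"
    by (simp add: entropy_objective_def rel_entropy_eq_SUP[OF assms] A_def c_def add.assoc)
  also have "\<dots> = - (SUP (y, z)\<in>A. ereal (y \<bullet> \<nu> + z \<bullet> lam) + ereal c)"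
    using SUP_ereal_add_left[OF ne, of "ereal c" "\<lambda>(y, z). ereal (y \<bullet> \<nu> + z \<bullet> lam)"]
    by (simp add: case_prod_unfold)
  also have "\<dots> = (INF (y, z)\<in>A. ereal (- (y \<bullet> \<nu> + z \<bullet> lam + c)))"
    by (simp add: ereal_INF_uminus_eq[symmetric] case_prod_unfold)
  finally show ?thesis by (simp add: A_def c_def)
qed

section \<open>Infimum of the Lagrangian and elimination of the multiplier \<mu>\<close>

text \<open>Moving each matrix to the other side of its inner product collects all terms in
  \<open>x\<close>; an infinite indicator absorbs the finite terms.\<close>

lemma lagrangian_eq:
  fixes Q R :: "real ^ 'k ^ 'n" and S :: "real ^ 'm ^ 'n"
  shows "lagrangian p Q R S u v w x y z \<nu> lam \<delta> \<mu> =
    (if exp_vec y + z \<le> 0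
     then ereal ((p + Q *v \<nu> + R *v lam + S *v \<delta> - \<mu>) \<bullet> x
       - (y \<bullet> \<nu> + z \<bullet> lam + (u \<bullet> \<nu> + v \<bullet> lam + w \<bullet> \<delta>)))
     else \<infinity>)"
proof -
  have tr: "(x v* M) \<bullet> a = (M *v a) \<bullet> x" for M :: "real ^ 'j ^ 'n" and a
    by (metis dot_lmul_matrix inner_commute)
  show ?thesis
    by (simp add: lagrangian_def exp_indicator_def inner_diff_left inner_add_left tr
        inner_commute[of x] algebra_simps)
qed

lemma INF_lagrangian_x:
  fixes Q R :: "real ^ 'k ^ 'n" and S :: "real ^ 'm ^ 'n"
  assumes "p + Q *v \<nu> + R *v lam + S *v \<delta> \<noteq> \<mu>" "exp_vec y + z \<le> 0"
  shows "(INF x. lagrangian p Q R S u v w x y z \<nu> lam \<delta> \<mu>) = -\<infinity>"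
proof -
  define c where "c = p + Q *v \<nu> + R *v lam + S *v \<delta> - \<mu>"
  define d where "d = y \<bullet> \<nu> + z \<bullet> lam + (u \<bullet> \<nu> + v \<bullet> lam + w \<bullet> \<delta>)"
  have c: "c \<bullet> c \<noteq> 0" using assms(1) by (simp add: c_def)
  have "(INF x. lagrangian p Q R S u v w x y z \<nu> lam \<delta> \<mu>) \<le> ereal B" for B
    using c assms(2) unfolding lagrangian_eq c_def[symmetric] d_def[symmetric]
    \<comment> \<open>The multiple of \<open>c\<close> at which the affine function
      \<open>c \<bullet> x - d\<close> takes exactly the value \<open>B\<close>.\<close>
    by (intro INF_lower2[where i = "((B + d) / (c \<bullet> c)) *\<^sub>R c"]) simp_all
  then show ?thesis by (rule ereal_bot)
qed

lemma dual_function_eq_entropy_objective: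
  fixes Q R :: "real ^ 'k ^ 'n" and S :: "real ^ 'm ^ 'n"
  assumes "0 \<le> \<nu>" "0 \<le> lam"
  shows "dual_function p Q R S u v w (\<nu>, lam, \<delta>, p + Q *v \<nu> + R *v lam + S *v \<delta>) =
    entropy_objective u v w (\<nu>, lam, \<delta>)"
  unfolding entropy_objective_eq_INF[OF assms] dual_function_def prod.case lagrangian_eq
    diff_self inner_zero_left diff_0
proof (rule antisym; rule INF_greatest, clarify)
  fix y z :: "real ^ 'k"
  assume "exp_vec y + z \<le> 0"
  then show "(INF (x, y, z)\<in>UNIV. if exp_vec y + z \<le> 0
      then ereal (- (y \<bullet> \<nu> + z \<bullet> lam + (u \<bullet> \<nu> + v \<bullet> lam + w \<bullet> \<delta>))) else \<infinity>)
    \<le> ereal (- (y \<bullet> \<nu> + z \<bullet> lam + (u \<bullet> \<nu> + v \<bullet> lam + w \<bullet> \<delta>)))"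
    \<comment> \<open>With a vanishing coefficient the value does not depend on \<open>x\<close>, so
      any point will do.\<close>
    by (intro INF_lower2[of "(undefined, y, z)"]) auto
next
  fix y z :: "real ^ 'k"
  show "(INF (y, z)\<in>{(y, z). exp_vec y + z \<le> 0}.
      ereal (- (y \<bullet> \<nu> + z \<bullet> lam + (u \<bullet> \<nu> + v \<bullet> lam + w \<bullet> \<delta>))))
    \<le> (if exp_vec y + z \<le> 0
      then ereal (- (y \<bullet> \<nu> + z \<bullet> lam + (u \<bullet> \<nu> + v \<bullet> lam + w \<bullet> \<delta>))) else \<infinity>)"
  proof (cases "exp_vec y + z \<le> 0")
    case True
    then show ?thesis by (intro INF_lower2[of "(y, z)"]) auto
  qed simp
qed

text \<open>Freezing \<open>(y, z)\<close> at \<open>(0, - 1)\<close> already leaves a nonconstant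
  affine function of \<open>x\<close>, which is unbounded below.\<close>

lemma dual_function_eq_MInfty:
  assumes "p + Q *v \<nu> + R *v lam + S *v \<delta> \<noteq> \<mu>"
  shows "dual_function p Q R S u v w (\<nu>, lam, \<delta>, \<mu>) = -\<infinity>"
proof -
  have "dual_function p Q R S u v w (\<nu>, lam, \<delta>, \<mu>)
      \<le> (INF x. lagrangian p Q R S u v w x 0 (- 1) \<nu> lam \<delta> \<mu>)"
    unfolding dual_function_def prod.case
    by (rule INF_greatest) (auto intro: INF_lower2[where i = "(_, 0, - 1)"])
  then show ?thesis
    by (simp add: INF_lagrangian_x[OF assms exp_vec_add_le_0_witness])
qed

text \<open>Boundedness in \<open>x\<close> forces the coefficient of \<open>x\<close> to vanish,
  which determines \<open>\<mu>\<close>; its membership in the dual cone then becomes the conic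
  constraint. Conversely, a vanishing coefficient makes the Lagrangian constant in \<open>x\<close>,
  finite or \<open>\<infinity>\<close>.\<close>

lemma x_bounded_multipliers_iff:
  "(\<nu>, lam, \<delta>, \<mu>) \<in> x_bounded_multipliers K p Q R S u v w \<longleftrightarrow>
    (\<nu>, lam, \<delta>) \<in> entropy_feasible K p Q R S \<and> \<mu> = p + Q *v \<nu> + R *v lam + S *v \<delta>"
proof (cases "\<mu> = p + Q *v \<nu> + R *v lam + S *v \<delta>")
  case True
  have "(INF x. lagrangian p Q R S u v w x y z \<nu> lam \<delta> \<mu>) \<noteq> -\<infinity>" for y z
    unfolding lagrangian_eq True by simp
  with True show ?thesis
    by (auto simp: x_bounded_multipliers_def multipliers_def entropy_feasible_def)
next
  case False
  then show ?thesis
    using INF_lagrangian_x[OF False[symmetric] exp_vec_add_le_0_witness, of u v w]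
    by (auto simp: x_bounded_multipliers_def)
qed

section \<open>Convexity of the entropy problem\<close>

lemma convex_dual_cone: "convex (dual_cone K)"
  by (auto simp: convex_def dual_cone_def inner_add_right)

lemma convex_entropy_feasible: "convex (entropy_feasible K p Q R S)"
  unfolding convex_alt
proof clarify
  fix \<nu> lam \<delta> \<nu>' lam' \<delta>' and t :: real
  assume d: "(\<nu>, lam, \<delta>) \<in> entropy_feasible K p Q R S"
    and d': "(\<nu>', lam', \<delta>') \<in> entropy_feasible K p Q R S" and t: "0 \<le> t" "t \<le> 1"
  \<comment> \<open>The constraint map is affine: the constant \<open>p\<close> splits because the
    weights add up to 1.\<close>
  have eq: "p + Q *v ((1 - t) *\<^sub>R \<nu> + t *\<^sub>R \<nu>') + R *v ((1 - t) *\<^sub>R lam + t *\<^sub>R lam')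
      + S *v ((1 - t) *\<^sub>R \<delta> + t *\<^sub>R \<delta>') =
    (1 - t) *\<^sub>R (p + Q *v \<nu> + R *v lam + S *v \<delta>) + t *\<^sub>R (p + Q *v \<nu>' + R *v lam' + S *v \<delta>')"
    by (simp add: matrix_vector_right_distrib matrix_vector_mult_scaleR algebra_simps)
  have "(1 - t) *\<^sub>R (p + Q *v \<nu> + R *v lam + S *v \<delta>)
      + t *\<^sub>R (p + Q *v \<nu>' + R *v lam' + S *v \<delta>') \<in> dual_cone K"
    using convex_dual_cone[of K] d d' t by (auto simp: convex_alt entropy_feasible_def)
  then show "(1 - t) *\<^sub>R (\<nu>, lam, \<delta>) + t *\<^sub>R (\<nu>', lam', \<delta>') \<in> entropy_feasible K p Q R S"
    using d d' t by (simp add: entropy_feasible_def eq less_eq_vec_def)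
qed

text \<open>Each \<open>g i\<close> majorises \<open>f\<close> at both endpoints, so its concavity
  bounds the convex combination of the values of \<open>f\<close>; then the infimum over
  \<open>i\<close> is taken. A single index keeps \<open>f\<close> below
  \<open>\<infinity>\<close>.\<close>

lemma concave_ereal_on_INF_concave_on:
  fixes g :: "'i \<Rightarrow> 'a::real_vector \<Rightarrow> real"
  assumes A: "convex A" and I: "I \<noteq> {}"
    and g: "\<And>i. i \<in> I \<Longrightarrow> concave_on A (g i)"
    and f: "\<And>x. x \<in> A \<Longrightarrow> f x = (INF i\<in>I. ereal (g i x))"
  shows "concave_ereal_on A f"
  unfolding concave_ereal_on_def
proof (intro conjI ballI allI impI A)
  have le: "f x \<le> ereal (g i x)" if "x \<in> A" "i \<in> I" for x i
    unfolding f[OF that(1)] using that(2) by (rule INF_lower)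
  show "f x \<noteq> \<infinity>" if "x \<in> A" for x
    using le[OF that] I by fastforce
  fix x y and t :: real
  assume xy: "x \<in> A" "y \<in> A" and t: "0 \<le> t" "t \<le> 1"
  have "(1 - t) *\<^sub>R x + t *\<^sub>R y \<in> A"
    using A xy t by (simp add: convex_alt)
  moreover have "ereal (1 - t) * f x + ereal t * f y
      \<le> ereal (g i ((1 - t) *\<^sub>R x + t *\<^sub>R y))" if i: "i \<in> I" for i
  proof -
    have "ereal (1 - t) * f x + ereal t * f y
        \<le> ereal (1 - t) * ereal (g i x) + ereal t * ereal (g i y)"
      using t le xy i by (intro add_mono ereal_mult_left_mono) auto
    also have "\<dots> \<le> ereal (g i ((1 - t) *\<^sub>R x + t *\<^sub>R y))"
      using concave_onD[OF g[OF i] t xy] by simp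
    finally show ?thesis .
  qed
  ultimately show "ereal (1 - t) * f x + ereal t * f y \<le> f ((1 - t) *\<^sub>R x + t *\<^sub>R y)"
    by (simp add: f INF_greatest)
qed

lemma concave_entropy_objective:
  fixes K :: "(real ^ 'n) set" and Q R :: "real ^ 'k ^ 'n" and S :: "real ^ 'm ^ 'n"
  shows "concave_ereal_on (entropy_feasible K p Q R S) (entropy_objective u v w)"
proof (rule concave_ereal_on_INF_concave_on[OF convex_entropy_feasible])
  show "{(y, z :: real ^ 'k). exp_vec y + z \<le> 0} \<noteq> {}"
    using exp_vec_add_le_0_witness by blast
  show "entropy_objective u v w d = (INF i\<in>{(y, z). exp_vec y + z \<le> 0}.
      ereal ((\<lambda>(y, z) (\<nu>, lam, \<delta>). - (y \<bullet> \<nu> + z \<bullet> lam + (u \<bullet> \<nu> + v \<bullet> lam + w \<bullet> \<delta>))) i d))"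
    if "d \<in> entropy_feasible K p Q R S" for d
    using that by (cases d) (simp add: entropy_feasible_def entropy_objective_eq_INF case_prod_unfold)
  show "concave_on (entropy_feasible K p Q R S)
      ((\<lambda>(y, z) (\<nu>, lam, \<delta>). - (y \<bullet> \<nu> + z \<bullet> lam + (u \<bullet> \<nu> + v \<bullet> lam + w \<bullet> \<delta>))) i)" for i
    by (cases i) (auto simp: concave_on_iff convex_entropy_feasible inner_add_right algebra_simps)
qed

section \<open>The split form of the primal\<close>

text \<open>The smallest admissible \<open>y\<close> and \<open>z\<close> are the affine expressions
  themselves; conversely, exp is monotone, so larger \<open>y\<close> and \<open>z\<close> only
  tighten the constraint.\<close>

lemma cgp_feasible_iff_split:
  "x \<in> cgp_feasible K Q R S u v w \<longleftrightarrow>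
    (\<exists>y z. (x, y, z) \<in> split_feasible K Q R S u v w \<and> exp_indicator y z = 0)"
proof
  assume "x \<in> cgp_feasible K Q R S u v w"
  then show "\<exists>y z. (x, y, z) \<in> split_feasible K Q R S u v w \<and> exp_indicator y z = 0"
    by (intro exI[of _ "transpose Q *v x - u"] exI[of _ "transpose R *v x - v"])
      (simp add: cgp_feasible_def split_feasible_def exp_indicator_def add_diff_eq)
next
  assume "\<exists>y z. (x, y, z) \<in> split_feasible K Q R S u v w \<and> exp_indicator y z = 0"
  then obtain y z where yz: "transpose Q *v x - u \<le> y" "transpose R *v x - v \<le> z"
      "transpose S *v x = w" "x \<in> K" "exp_vec y + z \<le> 0"
    by (auto simp: split_feasible_def exp_indicator_def split: if_splits)
  have "exp_vec (transpose Q *v x - u) \<le> exp_vec y"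
    using yz(1) by (simp add: exp_vec_def less_eq_vec_def)
  then have "exp_vec (transpose Q *v x - u) + (transpose R *v x - v) \<le> 0"
    using add_mono[OF _ yz(2)] yz(5) order_trans by blast
  then show "x \<in> cgp_feasible K Q R S u v w"
    using yz by (simp add: cgp_feasible_def add_diff_eq)
qed

text \<open>Split points with infinite indicator do not affect the infimum; all others have the
  objective value of the feasible point \<open>x\<close> they lie over.\<close>

lemma INF_cgp_eq_INF_split:
  "(INF x\<in>cgp_feasible K Q R S u v w. ereal (p \<bullet> x)) =
    (INF (x, y, z)\<in>split_feasible K Q R S u v w. ereal (p \<bullet> x) + exp_indicator y z)"
proof (rule antisym)
  show "(INF x\<in>cgp_feasible K Q R S u v w. ereal (p \<bullet> x))
    \<le> (INF (x, y, z)\<in>split_feasible K Q R S u v w. ereal (p \<bullet> x) + exp_indicator y z)"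
  proof (rule INF_greatest, clarify)
    fix x y z
    assume sf: "(x, y, z) \<in> split_feasible K Q R S u v w"
    show "(INF x\<in>cgp_feasible K Q R S u v w. ereal (p \<bullet> x)) \<le> ereal (p \<bullet> x) + exp_indicator y z"
    proof (cases "exp_indicator y z = 0")
      case True
      then have "x \<in> cgp_feasible K Q R S u v w"
        using sf cgp_feasible_iff_split by blast
      with True show ?thesis by (intro INF_lower2[of x]) simp_all
    next
      case False
      then have "exp_indicator y z = \<infinity>"
        by (auto simp: exp_indicator_def split: if_splits)
      then show ?thesis by simp
    qed
  qed
  show "(INF (x, y, z)\<in>split_feasible K Q R S u v w. ereal (p \<bullet> x) + exp_indicator y z)
    \<le> (INF x\<in>cgp_feasible K Q R S u v w. ereal (p \<bullet> x))"
  proof (rule INF_greatest)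
    fix x
    assume "x \<in> cgp_feasible K Q R S u v w"
    then obtain y z where yz: "(x, y, z) \<in> split_feasible K Q R S u v w" "exp_indicator y z = 0"
      using cgp_feasible_iff_split by blast
    then show "(INF (x, y, z)\<in>split_feasible K Q R S u v w. ereal (p \<bullet> x) + exp_indicator y z)
        \<le> ereal (p \<bullet> x)"
      by (intro INF_lower2[OF yz(1)]) simp
  qed
qed

section \<open>Identification of the dual problem\<close>

text \<open>Shows that excluding multipliers does not change the dual value: those with a nonzero
  coefficient of \<open>x\<close> contribute \<open>-\<infinity>\<close> to the supremum.\<close>

lemma SUP_dual_function_eq:
  fixes K :: "(real ^ 'n) set" and Q R :: "real ^ 'k ^ 'n" and S :: "real ^ 'm ^ 'n"
  shows "(SUP d\<in>multipliers K. dual_function p Q R S u v w d) =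
    (SUP d\<in>entropy_feasible K p Q R S. entropy_objective u v w d)"
proof (rule antisym)
  show "(SUP d\<in>multipliers K. dual_function p Q R S u v w d)
    \<le> (SUP d\<in>entropy_feasible K p Q R S. entropy_objective u v w d)"
  proof (rule SUP_least, clarify)
    fix \<nu> lam :: "real ^ 'k" and \<delta> :: "real ^ 'm" and \<mu> :: "real ^ 'n"
    assume m: "(\<nu>, lam, \<delta>, \<mu>) \<in> multipliers K"
    show "dual_function p Q R S u v w (\<nu>, lam, \<delta>, \<mu>)
      \<le> (SUP d\<in>entropy_feasible K p Q R S. entropy_objective u v w d)"
    proof (cases "p + Q *v \<nu> + R *v lam + S *v \<delta> = \<mu>")
      case True
      with m show ?thesis
        by (intro SUP_upper2[of "(\<nu>, lam, \<delta>)"])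
          (auto simp: multipliers_def entropy_feasible_def dual_function_eq_entropy_objective)
    next
      case False
      then show ?thesis by (simp add: dual_function_eq_MInfty)
    qed
  qed
  show "(SUP d\<in>entropy_feasible K p Q R S. entropy_objective u v w d)
    \<le> (SUP d\<in>multipliers K. dual_function p Q R S u v w d)"
  proof (rule SUP_least, clarify)
    fix \<nu> lam :: "real ^ 'k" and \<delta> :: "real ^ 'm"
    assume "(\<nu>, lam, \<delta>) \<in> entropy_feasible K p Q R S"
    then show "entropy_objective u v w (\<nu>, lam, \<delta>)
      \<le> (SUP d\<in>multipliers K. dual_function p Q R S u v w d)"
      by (intro SUP_upper2[of "(\<nu>, lam, \<delta>, p + Q *v \<nu> + R *v lam + S *v \<delta>)"])
        (auto simp: multipliers_def entropy_feasible_def dual_function_eq_entropy_objective)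
  qed
qed

lemma dual_feasible_eq_entropy_feasible:
  "dual_feasible K p Q R S u v w = entropy_feasible K p Q R S"
  by (auto simp: dual_feasible_def x_bounded_multipliers_iff)

text \<open>The partial maximization runs over a single \<open>\<mu>\<close>, the one that cancels
  the coefficient of \<open>x\<close>.\<close>

lemma dual_objective_eq_entropy_objective:
  assumes "d \<in> entropy_feasible K p Q R S"
  shows "dual_objective K p Q R S u v w d = entropy_objective u v w d"
proof (cases d)
  case (fields \<nu> lam \<delta>)
  then have "0 \<le> \<nu>" "0 \<le> lam"
    using assms by (auto simp: entropy_feasible_def)
  then show ?thesis
    using assms fields
    by (simp add: dual_objective_def x_bounded_multipliers_iff dual_function_eq_entropy_objective)
qed

theorem proposition2:
  fixes K :: "(real ^ 'n) set"
    and Q R :: "real ^ 'k ^ 'n"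
    and S :: "real ^ 'm ^ 'n"
    and u v :: "real ^ 'k"
    and w :: "real ^ 'm"
    and p :: "real ^ 'n"
  assumes "closed K" and "convex K" and "cone K" and "K \<noteq> {}"
  shows
    "(\<forall>x. x \<in> cgp_feasible K Q R S u v w \<longleftrightarrow>
        (\<exists>y z. (x, y, z) \<in> split_feasible K Q R S u v w \<and> exp_indicator y z = 0)) \<and>
     (INF x\<in>cgp_feasible K Q R S u v w. ereal (p \<bullet> x)) =
        (INF (x, y, z)\<in>split_feasible K Q R S u v w. ereal (p \<bullet> x) + exp_indicator y z) \<and>
     dual_feasible K p Q R S u v w = entropy_feasible K p Q R S \<and>
     (\<forall>d\<in>entropy_feasible K p Q R S.
        dual_objective K p Q R S u v w d = entropy_objective u v w d) \<and>
     (SUP d\<in>multipliers K. dual_function p Q R S u v w d) =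
        (SUP d\<in>entropy_feasible K p Q R S. entropy_objective u v w d) \<and>
     convex (entropy_feasible K p Q R S) \<and>
     concave_ereal_on (entropy_feasible K p Q R S) (entropy_objective u v w)"
  using cgp_feasible_iff_split INF_cgp_eq_INF_split dual_feasible_eq_entropy_feasible
    dual_objective_eq_entropy_objective SUP_dual_function_eq convex_entropy_feasible
    concave_entropy_objective
  by (intro conjI allI ballI)

end
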